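(* Let $r\ge1$ and let $k_0,\dots,k_r$ be nonnegative integers, and put $n=1+k_0+\cdots+k_r$. The number of $r$-permutations $\pi$ of $[n]$ such that $S(\pi)$ is the identity permutation $12\cdots n$ and such that, for each $i=0,\dots,r$, $\pi$ has exactly $k_i$ descents of type $i$, equals $$\frac{1}{n}\prod_{i=0}^{r}\binom{n}{k_i}.$$
   Context: An $r$-permutation of a finite set $A$ of positive integers is a word in which each element of $A$ appears exactly $r$ times, such that whenever $i<j<k$ and $a_i=a_k$ we have $a_j\le a_i$; for $A=[n]=\{1,\dots,n\}$ this is an $r$-permutation of $[n]$. The stack-sorting operation $S$: on words with distinct letters, $S(\emptyset)=\emptyset$ and if $m$ is the largest letter and $\pi=\pi_l\,m\,\pi_r$ then $S(\pi)=S(\pi_l)S(\pi_r)m$. On a nonempty $r$-permutation $\pi$ with largest letter $m$, write $\pi=\alpha_1 m\alpha_2 m\cdots m\alpha_{r+1}$ (each $\alpha_i$ is an $r$-permutation of some set, possibly empty) and set $S(\pi)=S(\alpha_1)S(\alpha_2)\cdots S(\alpha_{r+1})\,m$, with $S(\emptyset)=\emptyset$; $S(\pi)$ is a word with distinct letters. Descents: a letter $a$ of $\pi$ is a type $i$ descent ($1\le i\le r$) if the $i$th occurrence of $a$ is immediately followed by a smaller letter, and a type $0$ descent if the first occurrence of $a$ immediately follows a smaller letter. *)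

theory Defs
  imports Complex_Main
begin

definition r_permutation :: "nat \<Rightarrow> nat set \<Rightarrow> nat list \<Rightarrow> bool" where
  "r_permutation r A w \<longleftrightarrow>
     set w \<subseteq> A \<and> (\<forall>a\<in>A. count_list w a = r) \<and>
     (\<forall>i j k. i < j \<and> j < k \<and> k < length w \<and> w ! i = w ! k \<longrightarrow> w ! j \<le> w ! i)"

(* The list of (possibly empty) blocks of w cut out by the occurrences of m:
   for w = b1 m b2 m ... m bs with m in none of the bi this is [b1, ..., bs]
   (see split_letter_join). *)
fun split_letter :: "nat \<Rightarrow> nat list \<Rightarrow> nat list list" where
  "split_letter m [] = [[]]"
| "split_letter m (x # xs) =
     (if x = m then [] # split_letter m xs
      else (x # hd (split_letter m xs)) # tl (split_letter m xs))"

lemma split_letter_not_Nil [simp]: "split_letter m xs \<noteq> []"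
  by (cases xs) auto

lemma split_letter_length_le: "b \<in> set (split_letter m xs) \<Longrightarrow> length b \<le> length xs"
proof (induction m xs arbitrary: b rule: split_letter.induct)
  case (2 m x xs)
  then show ?case
    by (cases "split_letter m xs") (auto split: if_splits intro: le_SucI)
qed simp

lemma split_letter_length_less:
  "m \<in> set xs \<Longrightarrow> b \<in> set (split_letter m xs) \<Longrightarrow> length b < length xs"
proof (induction m xs arbitrary: b rule: split_letter.induct)
  case (2 m x xs)
  show ?case
  proof (cases "x = m")
    case True
    then show ?thesis
      using 2 split_letter_length_le by (fastforce simp: less_Suc_eq_le)
  next
    case False
    then show ?thesis
      using 2 by (cases "split_letter m xs") (auto intro: less_SucI)
  qed
qed simp

lemma split_letter_no_occurrence: "m \<notin> set b \<Longrightarrow> split_letter m b = [b]"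
  by (induction b) auto

lemma split_letter_append:
  "m \<notin> set b \<Longrightarrow> split_letter m (b @ m # xs) = b # split_letter m xs"
  by (induction b) auto

lemma split_letter_join:
  "\<forall>b\<in>set (bs @ [c]). m \<notin> set b \<Longrightarrow>
     split_letter m (concat (map (\<lambda>b. b @ [m]) bs) @ c) = bs @ [c]"
  by (induction bs) (auto simp: split_letter_append split_letter_no_occurrence)

(* Defined on all words, cutting at every occurrence of the largest letter.
   On words with distinct letters this is the classical stack-sorting operation;
   on r-permutations there are exactly r + 1 blocks. *)
function stack_sort :: "nat list \<Rightarrow> nat list" where
  "stack_sort w =
     (if w = [] then []
      else concat (map stack_sort (split_letter (Max (set w)) w)) @ [Max (set w)])"
  by auto
termination
  by (relation "measure length") (auto intro!: split_letter_length_less[rotated] Max_in)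

declare stack_sort.simps [simp del]

lemma stack_sort_Nil [simp]: "stack_sort [] = []"
  by (simp add: stack_sort.simps)

lemma stack_sort_join:
  assumes "bs \<noteq> []" and less: "\<forall>b\<in>set (bs @ [c]). \<forall>x\<in>set b. x < m"
  shows "stack_sort (concat (map (\<lambda>b. b @ [m]) bs) @ c) =
           concat (map stack_sort bs) @ stack_sort c @ [m]"
proof -
  let ?w = "concat (map (\<lambda>b. b @ [m]) bs) @ c"
  have "m \<in> set ?w" using assms(1) by (cases bs) auto
  moreover have "\<forall>x\<in>set ?w. x \<le> m" using less by (auto intro: less_imp_le)
  ultimately have "Max (set ?w) = m" by (intro Max_eqI) auto
  moreover have "split_letter m ?w = bs @ [c]"
    using less by (intro split_letter_join) auto
  moreover have "?w \<noteq> []" using assms(1) by (cases bs) auto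
  ultimately show ?thesis
    by (subst stack_sort.simps) simp
qed

(* For i > 0 the displayed letter a is its i-th occurrence in w; for i = 0 it is
   the first one (b < a, so a does not occur in u @ [b]). *)
definition is_descent :: "nat \<Rightarrow> nat list \<Rightarrow> nat \<Rightarrow> bool" where
  "is_descent i w a \<longleftrightarrow>
     (if i = 0
      then (\<exists>u b v. w = u @ [b, a] @ v \<and> a \<notin> set u \<and> b < a)
      else (\<exists>u b v. w = u @ [a, b] @ v \<and> Suc (count_list u a) = i \<and> b < a))"

definition num_descents :: "nat \<Rightarrow> nat list \<Rightarrow> nat" where
  "num_descents i w = card {a \<in> set w. is_descent i w a}"

end

theory Submission
  imports Defs
begin

text \<open>
  If \<open>w\<close> consists of the blocks \<open>b\<^sub>0, \<dots>, b\<^sub>r\<close> separated by its largest letter \<open>m\<close>, then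
  \<open>m\<close> is a descent of type \<open>i\<close> exactly when \<open>b\<^sub>i\<close> is nonempty, and all other descents
  of \<open>w\<close> are those of the blocks. So the words sorted to the identity behave like
  \<open>(r + 1)\<close>-ary trees with \<open>n\<close> vertices, a descent of type \<open>i\<close> being a vertex with a child in
  position \<open>i\<close>. We count, more generally, sequences of \<open>m\<close> nonempty words whose sorted images
  concatenate to \<open>1 2 \<dots> n\<close>. The letter \<open>n\<close> is then the largest letter of the \<^emph>\<open>last\<close> word, and
  deleting it leaves a sequence of \<open>m - 1 + |A|\<close> words on \<open>1, \<dots>, n - 1\<close>, where \<open>A\<close> is the set
  of positions of nonempty blocks; no relabelling is needed. By induction on \<open>n\<close> this
  recurrence has the solution \<open>m/n * (\<Prod>i\<le>r. n choose k i)\<close> whenever \<open>m + (\<Sum>i\<le>r. k i) = n\<close>.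
\<close>

subsection \<open>Joining blocks by a letter\<close>

text \<open>Inverse to \<open>split_letter m\<close> on nonempty lists of blocks that avoid
  \<open>m\<close>. The separators stand only between blocks, so \<open>r + 1\<close> blocks produce
  \<open>r\<close> copies of \<open>m\<close>, and the recursion peels off the first block, which is
  the shape of the inductions below.\<close>

fun join_letter :: "nat \<Rightarrow> nat list list \<Rightarrow> nat list" where
  "join_letter m [] = []"
| "join_letter m [b] = b"
| "join_letter m (b # b' # bs) = b @ m # join_letter m (b' # bs)"

lemma join_letter_Cons: "bs \<noteq> [] \<Longrightarrow> join_letter m (b # bs) = b @ m # join_letter m bs"
  by (cases bs) auto

lemma join_letter_split_letter: "join_letter m (split_letter m w) = w"
proof (induction m w rule: split_letter.induct)
  case (2 m x w)
  then show ?case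
    by (cases "(m, split_letter m w)" rule: join_letter.cases) (auto simp: join_letter_Cons)
qed simp

lemma split_letter_join_letter:
  "bs \<noteq> [] \<Longrightarrow> \<forall>b\<in>set bs. m \<notin> set b \<Longrightarrow> split_letter m (join_letter m bs) = bs"
  by (induction m bs rule: join_letter.induct)
     (auto simp: split_letter_append split_letter_no_occurrence)

lemma join_letter_snoc:
  "join_letter m (bs @ [c]) = concat (map (\<lambda>b. b @ [m]) bs) @ c"
  by (induction bs) (auto simp: join_letter_Cons)

text \<open>Two blocks guarantee that \<open>m\<close> occurs and hence is the letter at which
  \<open>stack_sort\<close> cuts. With a single block, \<open>m\<close> would be absent.\<close>

lemma stack_sort_join_letter:
  assumes "2 \<le> length bs" "\<forall>b\<in>set bs. \<forall>x\<in>set b. x < m"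
  shows "stack_sort (join_letter m bs) = concat (map stack_sort bs) @ [m]"
proof -
  obtain cs c where bs: "bs = cs @ [c]"
    using assms(1) by (cases bs rule: rev_cases) auto
  then have "cs \<noteq> []" using assms(1) by auto
  then show ?thesis
    using assms(2) stack_sort_join[of cs c m] by (simp add: bs join_letter_snoc)
qed

lemma length_split_letter: "length (split_letter m w) = Suc (count_list w m)"
proof (induction m w rule: split_letter.induct)
  case (2 m x w)
  then show ?case by (cases "split_letter m w") auto
qed simp

lemma set_split_letter: "(\<Union>b\<in>set (split_letter m w). set b) = set w - {m}"
proof (induction m w rule: split_letter.induct)
  case (2 m x w)
  then show ?case by (cases "split_letter m w") auto
qed simp

lemma set_stack_sort [simp]: "set (stack_sort w) = set w"
proof (induction w rule: stack_sort.induct)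
  case (1 w)
  show ?case
  proof (cases "w = []")
    case False
    have "set (stack_sort w) =
        (\<Union>b\<in>set (split_letter (Max (set w)) w). set (stack_sort b)) \<union> {Max (set w)}"
      using False by (subst stack_sort.simps) auto
    also have "\<dots> = (\<Union>b\<in>set (split_letter (Max (set w)) w). set b) \<union> {Max (set w)}"
      using 1 False by auto
    also have "\<dots> = set w"
      using False by (auto simp: set_split_letter)
    finally show ?thesis .
  qed simp
qed

lemma last_stack_sort: "w \<noteq> [] \<Longrightarrow> last (stack_sort w) = Max (set w)"
  by (subst stack_sort.simps) auto

lemma stack_sort_eq_Nil_iff [simp]: "stack_sort w = [] \<longleftrightarrow> w = []"
  by (metis set_empty set_stack_sort)

subsection \<open>Permutations and descents of a joined word\<close>

text \<open>The one clause of \<open>r_permutation\<close> that mentions neither \<open>r\<close>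
  nor the ground set. Isolating it lets it be decomposed block by block.\<close>

definition nested :: "nat list \<Rightarrow> bool" where
  "nested w \<longleftrightarrow> (\<forall>i j k. i < j \<and> j < k \<and> k < length w \<and> w ! i = w ! k \<longrightarrow> w ! j \<le> w ! i)"

lemma nestedD:
  "nested w \<Longrightarrow> i < j \<Longrightarrow> j < k \<Longrightarrow> k < length w \<Longrightarrow> w ! i = w ! k \<Longrightarrow> w ! j \<le> w ! i"
  by (simp add: nested_def)

text \<open>Take two equal letters and a position between them. If one of the two is the displayed
  \<open>m\<close>, their value bounds every letter of the word. Otherwise both lie on the same side
  of it, since the two sides share no letter. The right side may itself contain further copies of
  \<open>m\<close>.\<close>

lemma nested_append_Cons:
  assumes "\<forall>x\<in>set b. x < m" "\<forall>x\<in>set w. x \<le> m" "set b \<inter> set w = {}"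
  shows "nested (b @ m # w) \<longleftrightarrow> nested b \<and> nested w"
proof -
  let ?v = "b @ m # w" and ?l = "length b"
  have left: "?v ! j = b ! j" if "j < ?l" for j
    using that by (simp add: nth_append)
  have right: "?v ! (Suc ?l + j) = w ! j" for j
    by (simp add: nth_append)
  show ?thesis
  proof
    assume n: "nested ?v"
    have "nested b"
      unfolding nested_def
    proof (intro allI impI, elim conjE)
      fix i j k assume ijk: "i < j" "j < k" "k < length b" "b ! i = b ! k"
      then have "?v ! j \<le> ?v ! i"
        by (intro nestedD[OF n, of i j k]) (simp_all add: left)
      then show "b ! j \<le> b ! i" using ijk by (simp add: left)
    qed
    moreover have "nested w"
      unfolding nested_def
    proof (intro allI impI, elim conjE)
      fix i j k assume "i < j" "j < k" "k < length w" "w ! i = w ! k"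
      then have "?v ! (Suc ?l + j) \<le> ?v ! (Suc ?l + i)"
        by (intro nestedD[OF n, of _ _ "Suc ?l + k"]) (simp_all only: right, simp_all)
      then show "w ! j \<le> w ! i" by (simp only: right)
    qed
    ultimately show "nested b \<and> nested w" ..
  next
    assume n: "nested b \<and> nested w"
    have le: "?v ! j \<le> m" if "j < length ?v" for j
    proof -
      have "\<forall>x\<in>set ?v. x \<le> m" using assms by (auto intro: less_imp_le)
      then show ?thesis using nth_mem[OF that] by blast
    qed
    show "nested ?v"
      unfolding nested_def
    proof (intro allI impI, elim conjE)
      fix i j k assume ijk: "i < j" "j < k" "k < length ?v" "?v ! i = ?v ! k"
      have "i = ?l \<or> k = ?l \<or> k < ?l \<or> ?l < i \<or> i < ?l \<and> ?l < k" by linarith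
      then consider "?v ! i = m" | "k < ?l" | "?l < i" | "i < ?l" "?l < k"
        using ijk(4) by (metis nth_append_length)
      then show "?v ! j \<le> ?v ! i"
      proof cases
        case 1
        then show ?thesis using le[of j] ijk by linarith
      next
        case 2
        then show ?thesis
          using nestedD[of b i j k] n ijk by (simp add: left)
      next
        case 3
        then obtain i' j' k' where "i = Suc ?l + i'" "j = Suc ?l + j'" "k = Suc ?l + k'"
          using ijk by (metis Suc_leI less_trans nat_le_iff_add)
        then show ?thesis
          using nestedD[of w i' j' k'] n ijk by (simp only: right) simp
      next
        case 4
        then obtain k' where k': "k = Suc ?l + k'"
          by (metis Suc_leI nat_le_iff_add)
        have "?v ! i \<in> set b" using 4 by (simp add: left)
        moreover have "?v ! k \<in> set w"
          using ijk(3) unfolding k' right by simp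
        ultimately show ?thesis using assms(3) ijk(4) by auto
      qed
    qed
  qed
qed

text \<open>The words of a forest use different sets of letters, so each is taken as a permutation
  of its own letter set.\<close>

lemma r_permutation_set_iff:
  "r_permutation r (set w) w \<longleftrightarrow> nested w \<and> (\<forall>a\<in>set w. count_list w a = r)"
  by (auto simp: r_permutation_def nested_def)

lemma count_list_join_letter:
  "bs \<noteq> [] \<Longrightarrow> \<forall>b\<in>set bs. m \<notin> set b \<Longrightarrow> Suc (count_list (join_letter m bs) m) = length bs"
  by (induction m bs rule: join_letter.induct) auto

lemma set_join_letter: "set (join_letter m bs) \<subseteq> insert m (\<Union>b\<in>set bs. set b)"
  by (induction m bs rule: join_letter.induct) auto

lemma set_join_letter_eq:
  "2 \<le> length bs \<Longrightarrow> set (join_letter m bs) = insert m (\<Union>b\<in>set bs. set b)"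
proof (induction m bs rule: join_letter.induct)
  case (3 m b b' bs)
  then show ?case by (cases bs) auto
qed auto

text \<open>Multiplicities are required only for letters other than \<open>m\<close>, because the
  number of copies of \<open>m\<close> drops along the induction on the blocks while
  \<open>r\<close> stays fixed. Distinctness of the concatenated sorted images expresses that the
  blocks have pairwise disjoint letter sets, as sorting preserves the set of letters.\<close>

lemma nested_count_join_letter:
  assumes "bs \<noteq> []" "\<forall>b\<in>set bs. \<forall>x\<in>set b. x < m" "distinct (concat (map stack_sort bs))"
  shows "nested (join_letter m bs) \<and>
      (\<forall>a\<in>set (join_letter m bs) - {m}. count_list (join_letter m bs) a = r) \<longleftrightarrow>
    (\<forall>b\<in>set bs. r_permutation r (set b) b)"
  using assms
proof (induction m bs rule: join_letter.induct)
  case (2 m b)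
  then show ?case by (auto simp: r_permutation_set_iff)
next
  case (3 m b b' bs)
  let ?w = "join_letter m (b' # bs)"
  have sub: "set ?w \<subseteq> insert m (\<Union>c\<in>set (b' # bs). set c)"
    by (rule set_join_letter)
  have disj: "set b \<inter> set ?w = {}"
    using sub 3(3,4) by fastforce
  have le: "\<forall>x\<in>set ?w. x \<le> m"
  proof
    fix x assume "x \<in> set ?w"
    then have "x = m \<or> x < m" using sub 3(3) by fastforce
    then show "x \<le> m" by auto
  qed
  have nest: "nested (b @ m # ?w) \<longleftrightarrow> nested b \<and> nested ?w"
    using 3(3) le disj by (intro nested_append_Cons) auto
  have m: "m \<notin> set b" using 3(3) by auto
  have b: "count_list (b @ m # ?w) a = count_list b a" if "a \<in> set b" for a
    using that disj m by (auto simp: count_list_0_iff)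
  have w: "count_list (b @ m # ?w) a = count_list ?w a" if "a \<in> set ?w - {m}" for a
    using that disj by (auto simp: count_list_0_iff)
  have IH: "(nested ?w \<and> (\<forall>a\<in>set ?w - {m}. count_list ?w a = r)) \<longleftrightarrow>
      (\<forall>b\<in>set (b' # bs). r_permutation r (set b) b)"
    using 3(3,4) by (intro 3(1)) simp_all
  have "(\<forall>a\<in>set (b @ m # ?w) - {m}. count_list (b @ m # ?w) a = r) \<longleftrightarrow>
      (\<forall>a\<in>set b. count_list b a = r) \<and> (\<forall>a\<in>set ?w - {m}. count_list ?w a = r)"
    (is "?A \<longleftrightarrow> ?B \<and> ?C")
  proof -
    have "set (b @ m # ?w) - {m} = set b \<union> (set ?w - {m})"
      using m by auto
    then have "?A \<longleftrightarrow> (\<forall>a\<in>set b. count_list (b @ m # ?w) a = r) \<and>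
        (\<forall>a\<in>set ?w - {m}. count_list (b @ m # ?w) a = r)"
      by (simp only: ball_Un)
    then show ?thesis
      using b w by (simp only: cong: ball_cong)
  qed
  then show ?case
    unfolding join_letter.simps(3) nest using IH
    by (simp only: r_permutation_set_iff list.set ball_simps(7)) blast
qed simp

lemma r_permutation_join_letter:
  assumes "length bs = Suc r" "\<forall>b\<in>set bs. \<forall>x\<in>set b. x < m"
    "distinct (concat (map stack_sort bs))"
  shows "r_permutation r (set (join_letter m bs)) (join_letter m bs) \<longleftrightarrow>
    (\<forall>b\<in>set bs. r_permutation r (set b) b)"
proof -
  have "bs \<noteq> []" using assms(1) by auto
  moreover have "\<forall>b\<in>set bs. m \<notin> set b" using assms(2) by blast
  ultimately have "count_list (join_letter m bs) m = r"
    using count_list_join_letter[of bs m] assms(1) by simp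
  then show ?thesis
    using nested_count_join_letter[OF \<open>bs \<noteq> []\<close> assms(2,3), of r]
    unfolding r_permutation_set_iff[of r "join_letter m bs"] by blast
qed

section \<open>Descents of a joined word\<close>

lemma not_is_descent_Nil [simp]: "\<not> is_descent i [] a"
  by (auto simp: is_descent_def)

text \<open>This and the next lemma turn the existential definition of descents into recursions on
  the word, so that descents can be handled by induction on the left block.\<close>

lemma is_descent_0_Cons:
  "is_descent 0 (x # w) a \<longleftrightarrow> (w \<noteq> [] \<and> hd w = a \<and> x < a) \<or> (x \<noteq> a \<and> is_descent 0 w a)"
  (is "?L \<longleftrightarrow> ?R")
proof
  assume ?L
  then obtain u b v where u: "x # w = u @ [b, a] @ v" "a \<notin> set u" "b < a"
    by (auto simp: is_descent_def)
  then show ?R by (cases u) (auto simp: is_descent_def)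
next
  assume ?R
  then show ?L
  proof
    assume "w \<noteq> [] \<and> hd w = a \<and> x < a"
    then have "x # w = [] @ [x, a] @ tl w" "x < a" by auto
    then show ?L unfolding is_descent_def by (metis empty_iff list.set(1))
  next
    assume R: "x \<noteq> a \<and> is_descent 0 w a"
    then obtain u b v where "w = u @ [b, a] @ v" "a \<notin> set u" "b < a"
      by (auto simp: is_descent_def)
    then have "x # w = (x # u) @ [b, a] @ v" "a \<notin> set (x # u)" "b < a" using R by auto
    then show ?L unfolding is_descent_def by metis
  qed
qed

text \<open>A leading \<open>a\<close> uses up one occurrence and lowers the type by one. At type 1
  it is itself the letter whose successor matters.\<close>

lemma is_descent_Suc_Cons:
  "is_descent (Suc i) (x # w) a \<longleftrightarrow>
    (if x = a then if i = 0 then w \<noteq> [] \<and> hd w < a else is_descent i w a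
     else is_descent (Suc i) w a)"
  (is "?L \<longleftrightarrow> ?R")
proof
  assume ?L
  then obtain u b v where u: "x # w = u @ [a, b] @ v" "count_list u a = i" "b < a"
    by (auto simp: is_descent_def)
  then show ?R
  proof (cases u)
    case (Cons y u')
    then have "w = u' @ [a, b] @ v" "count_list u' a = (if x = a then i - 1 else i)"
      "x = a \<longrightarrow> i > 0"
      using u by auto
    then show ?thesis
      using u(3) by (cases "x = a"; cases i) (auto simp: is_descent_def)
  qed auto
next
  assume R: ?R
  show ?L
  proof (cases "x = a \<and> i = 0")
    case True
    then have "x # w = [] @ [a, hd w] @ tl w" "hd w < a" "Suc (count_list [] a) = Suc i"
      using R by auto
    then show ?thesis unfolding is_descent_def by (metis nat.simps(3))
  next
    case False
    then obtain u b v where "w = u @ [a, b] @ v"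
      "Suc (count_list u a) = (if x = a then i else Suc i)" "b < a"
      using R by (auto simp: is_descent_def split: if_splits)
    then have "x # w = (x # u) @ [a, b] @ v" "Suc (count_list (x # u) a) = Suc i" "b < a"
      by (auto split: if_splits)
    then show ?thesis unfolding is_descent_def by (metis nat.simps(3))
  qed
qed

lemma is_descent_in_set: "is_descent i w a \<Longrightarrow> a \<in> set w"
  by (auto simp: is_descent_def split: if_splits)

text \<open>Next to an \<open>a\<close>, the larger letter \<open>m\<close> is never the smaller
  neighbour that a descent requires, so it creates none. Since \<open>a\<close> occurs on at most
  one side, the numbering of its occurrences does not change either.\<close>

lemma is_descent_append_Cons:
  "a < m \<Longrightarrow> a \<notin> set b \<inter> set w \<Longrightarrow>
    is_descent i (b @ m # w) a \<longleftrightarrow> is_descent i b a \<or> is_descent i w a"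
proof (induction b arbitrary: i)
  case Nil
  then show ?case
    by (cases i) (auto simp: is_descent_0_Cons is_descent_Suc_Cons)
next
  case (Cons x b)
  then have IH: "is_descent i (b @ m # w) a \<longleftrightarrow> is_descent i b a \<or> is_descent i w a" for i
    by auto
  have no: "\<not> is_descent i w a" if "x = a" for i
    using that Cons.prems by (auto dest: is_descent_in_set)
  have eq: "hd (b @ m # w) = a \<longleftrightarrow> b \<noteq> [] \<and> hd b = a"
    and less: "hd (b @ m # w) < a \<longleftrightarrow> b \<noteq> [] \<and> hd b < a"
    using Cons.prems by (cases b; auto)+
  show ?case
    by (cases i) (use no in \<open>auto simp: is_descent_0_Cons is_descent_Suc_Cons IH eq less\<close>)
qed

lemma is_descent_max_0: "\<forall>x\<in>set b. x < m \<Longrightarrow> is_descent 0 (b @ m # w) m \<longleftrightarrow> b \<noteq> []"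
proof (induction b)
  case (Cons x b)
  then show ?case by (cases b) (auto simp: is_descent_0_Cons)
qed (auto simp: is_descent_0_Cons)

lemma is_descent_max_Suc:
  "m \<notin> set b \<Longrightarrow> is_descent (Suc i) (b @ m # w) m \<longleftrightarrow>
    (if i = 0 then w \<noteq> [] \<and> hd w < m else is_descent i w m)"
  by (induction b) (auto simp: is_descent_Suc_Cons)

lemma is_descent_join_letter_Suc:
  "bs \<noteq> [] \<Longrightarrow> \<forall>b\<in>set bs. \<forall>x\<in>set b. x < m \<Longrightarrow> Suc i < length bs \<Longrightarrow>
    is_descent (Suc i) (join_letter m bs) m \<longleftrightarrow> bs ! Suc i \<noteq> []"
proof (induction m bs arbitrary: i rule: join_letter.induct)
  case (3 m b b' bs)
  have "m \<notin> set b" using 3(3) by auto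
  note max = is_descent_max_Suc[OF this]
  show ?case
  proof (cases i)
    case 0
    have "join_letter m (b' # bs) \<noteq> [] \<and> hd (join_letter m (b' # bs)) < m \<longleftrightarrow> b' \<noteq> []"
      using 3(3) by (cases bs; cases b') auto
    then show ?thesis using 0 by (simp add: max)
  next
    case (Suc j)
    then show ?thesis using 3 by (simp add: max)
  qed
qed auto

text \<open>For \<open>i > 0\<close> the \<open>i\<close>-th \<open>m\<close> is followed by block
  \<open>i\<close>: a smaller letter if that block is nonempty, otherwise another \<open>m\<close>
  or the end of the word. The first \<open>m\<close> is preceded by block 0. Thus descent types at
  the root correspond to positions of children.\<close>

lemma is_descent_join_letter:
  assumes "2 \<le> length bs" "\<forall>b\<in>set bs. \<forall>x\<in>set b. x < m" "i < length bs"
  shows "is_descent i (join_letter m bs) m \<longleftrightarrow> bs ! i \<noteq> []"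
proof (cases i)
  case 0
  then show ?thesis
    using assms by (cases "(m, bs)" rule: join_letter.cases) (auto simp: is_descent_max_0)
next
  case (Suc j)
  then show ?thesis
    using assms is_descent_join_letter_Suc[of bs m j] by fastforce
qed

text \<open>Away from \<open>m\<close> descents are additive over blocks, again because the blocks
  share no letters. The letter \<open>m\<close> is excluded since its own descents depend on how all
  blocks are arranged.\<close>

lemma card_descents_less_join_letter:
  "bs \<noteq> [] \<Longrightarrow> \<forall>b\<in>set bs. \<forall>x\<in>set b. x < m \<Longrightarrow> distinct (concat (map stack_sort bs)) \<Longrightarrow>
    card {a \<in> set (join_letter m bs) - {m}. is_descent i (join_letter m bs) a} =
      (\<Sum>b\<leftarrow>bs. num_descents i b)"
proof (induction m bs rule: join_letter.induct)
  case (2 m b)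
  then have "m \<notin> set b" by auto
  then show ?case by (simp add: num_descents_def)
next
  case (3 m b b' bs)
  let ?w = "join_letter m (b' # bs)"
  have sub: "set ?w \<subseteq> insert m (\<Union>c\<in>set (b' # bs). set c)"
    by (rule set_join_letter)
  have disj: "set b \<inter> set ?w = {}"
    using sub 3(3,4) by fastforce
  have le: "a < m" if "a \<in> set ?w - {m}" for a
    using sub 3(3) that by fastforce
  have bm: "\<forall>x\<in>set b. x < m" using 3(3) by auto
  have eq: "is_descent i (b @ m # ?w) a \<longleftrightarrow> is_descent i b a \<or> is_descent i ?w a"
    if "a \<in> set b \<union> set ?w - {m}" for a
    using that le bm disj by (intro is_descent_append_Cons) auto
  have "{a \<in> set (b @ m # ?w) - {m}. is_descent i (b @ m # ?w) a} =
      {a \<in> set b. is_descent i b a} \<union> {a \<in> set ?w - {m}. is_descent i ?w a}"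
    (is "?D = ?B \<union> ?W")
    using bm eq by (auto dest: is_descent_in_set)
  moreover have "card (?B \<union> ?W) = card ?B + card ?W"
    using disj by (intro card_Un_disjoint) auto
  moreover have "card ?W = (\<Sum>b\<leftarrow>b' # bs. num_descents i b)"
    using 3 by auto
  ultimately show ?case by (simp add: num_descents_def)
qed simp

lemma num_descents_join_letter:
  assumes "2 \<le> length bs" "\<forall>b\<in>set bs. \<forall>x\<in>set b. x < m" "i < length bs"
    "distinct (concat (map stack_sort bs))"
  shows "num_descents i (join_letter m bs) =
    (\<Sum>b\<leftarrow>bs. num_descents i b) + (if bs ! i \<noteq> [] then 1 else 0)"
proof -
  let ?w = "join_letter m bs"
  let ?D = "{a \<in> set ?w - {m}. is_descent i ?w a}"
  have "{a \<in> set ?w. is_descent i ?w a} = (if bs ! i \<noteq> [] then insert m ?D else ?D)"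
    using is_descent_join_letter[OF assms(1-3)]
    by (auto simp: set_join_letter_eq[OF assms(1)])
  moreover have "card ?D = (\<Sum>b\<leftarrow>bs. num_descents i b)"
    using assms by (intro card_descents_less_join_letter) auto
  ultimately show ?thesis by (simp add: num_descents_def)
qed

section \<open>Encoding a block sequence by its support\<close>

definition nonempty_positions :: "nat list list \<Rightarrow> nat set" where
  "nonempty_positions bs = {i. i < length bs \<and> bs ! i \<noteq> []}"

text \<open>With the lemma after it: a list of \<open>l\<close> blocks amounts to a set of positions
  below \<open>l\<close> together with the nonempty blocks in order. This is why deleting a root
  only has to remember the set of positions of its children.\<close>

lemma nonempty_positions_inject:
  assumes "length bs = length cs" "nonempty_positions bs = nonempty_positions cs"
    "filter (\<lambda>b. b \<noteq> []) bs = filter (\<lambda>b. b \<noteq> []) cs"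
  shows "bs = cs"
proof -
  have "\<forall>i<length bs. bs ! i = [] \<longleftrightarrow> cs ! i = []"
    using assms(1,2) by (auto simp: nonempty_positions_def set_eq_iff)
  then show ?thesis
    using assms(1,3)
  proof (induction cs arbitrary: bs)
    case (Cons c cs)
    then obtain b bs' where bs: "bs = b # bs'" by (cases bs) auto
    have e: "b = [] \<longleftrightarrow> c = []" and rest: "\<forall>i<length bs'. bs' ! i = [] \<longleftrightarrow> cs ! i = []"
      using Cons.prems(1) unfolding bs by (simp_all add: All_less_Suc2)
    have "length bs' = length cs" using Cons.prems(2) bs by simp
    moreover have "filter (\<lambda>b. b \<noteq> []) bs' = filter (\<lambda>b. b \<noteq> []) cs" "b = c"
      using Cons.prems(3) e bs by (simp_all split: if_splits)
    ultimately show ?case using Cons.IH rest bs by simp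
  qed simp
qed

lemma nonempty_positions_exist:
  assumes "A \<subseteq> {..<l}" "length vs = card A" "[] \<notin> set vs"
  shows "\<exists>bs. length bs = l \<and> nonempty_positions bs = A \<and> filter (\<lambda>b. b \<noteq> []) bs = vs"
  using assms
proof (induction l arbitrary: A vs)
  case 0
  then show ?case by (auto simp: nonempty_positions_def)
next
  case (Suc l)
  have fin: "finite A" using Suc.prems(1) finite_subset by blast
  have snoc: "nonempty_positions (bs @ [b]) =
      (if b = [] then nonempty_positions bs else insert (length bs) (nonempty_positions bs))"
    for bs b
  proof -
    have "i \<in> nonempty_positions (bs @ [b]) \<longleftrightarrow>
        i \<in> nonempty_positions bs \<or> i = length bs \<and> b \<noteq> []" for i
      unfolding nonempty_positions_def
      by (cases "i < length bs"; cases "i = length bs") (simp_all add: nth_append)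
    then show ?thesis by auto
  qed
  show ?case
  proof (cases "l \<in> A")
    case True
    then have card: "card A = Suc (card (A - {l}))" using card_Suc_Diff1[OF fin] by metis
    then obtain vs' v where vs: "vs = vs' @ [v]"
      using Suc.prems(2) by (cases vs rule: rev_cases) auto
    then have "length vs' = card (A - {l})" using card Suc.prems(2) by simp
    moreover have "A - {l} \<subseteq> {..<l}" using Suc.prems(1) by (auto simp: less_Suc_eq)
    ultimately obtain bs where "length bs = l" "nonempty_positions bs = A - {l}"
        "filter (\<lambda>b. b \<noteq> []) bs = vs'"
      using Suc.IH[of "A - {l}" vs'] Suc.prems(3) vs by auto
    then have "length (bs @ [v]) = Suc l \<and> nonempty_positions (bs @ [v]) = A \<and>
        filter (\<lambda>b. b \<noteq> []) (bs @ [v]) = vs"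
      using vs Suc.prems(3) True by (auto simp: snoc)
    then show ?thesis by blast
  next
    case False
    then have "A \<subseteq> {..<l}" using Suc.prems(1) by (auto simp: less_Suc_eq)
    then obtain bs where "length bs = l" "nonempty_positions bs = A"
        "filter (\<lambda>b. b \<noteq> []) bs = vs"
      using Suc.IH[of A vs] Suc.prems by auto
    then have "length (bs @ [[]]) = Suc l \<and> nonempty_positions (bs @ [[]]) = A \<and>
        filter (\<lambda>b. b \<noteq> []) (bs @ [[]]) = vs"
      by (auto simp: snoc)
    then show ?thesis by blast
  qed
qed

lemma card_nonempty_positions:
  "card (nonempty_positions bs) = length (filter (\<lambda>b. b \<noteq> []) bs)"
  by (simp add: nonempty_positions_def length_filter_conv_card)

subsection \<open>Forests of sortable words\<close>

text \<open>
  The words of a forest in \<open>sorted_forests r m n k\<close> are the \<open>m\<close> trees; \<open>k i\<close> is the number of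
  vertices having a child in position \<open>i\<close>.
\<close>

definition sorted_forests :: "nat \<Rightarrow> nat \<Rightarrow> nat \<Rightarrow> (nat \<Rightarrow> nat) \<Rightarrow> nat list list set" where
  "sorted_forests r m n k = {ws. length ws = m \<and>
     (\<forall>w\<in>set ws. w \<noteq> [] \<and> r_permutation r (set w) w) \<and>
     concat (map stack_sort ws) = [1..<Suc n] \<and>
     (\<forall>i\<le>r. (\<Sum>w\<leftarrow>ws. num_descents i w) = k i)}"

text \<open>Deleting the last root removes exactly the final letter \<open>Suc n\<close> from the
  concatenated sorted images, and dropping empty blocks changes neither that concatenation nor the
  descent counts. The root contributed one descent for each nonempty position. As subtraction of
  naturals is truncated, \<open>k' bs\<close> loses the information \<open>0 < k i\<close>, which is
  therefore stated separately.\<close>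

lemma sorted_forests_join:
  fixes n :: nat and k :: "nat \<Rightarrow> nat"
  defines "\<And>bs. k' bs \<equiv> \<lambda>i. k i - (if i \<in> nonempty_positions bs then 1 else 0)"
  assumes r: "r \<ge> 1" and len: "length bs = Suc r"
    and less: "\<forall>b\<in>set bs. \<forall>x\<in>set b. x < Suc n" and m: "length ws = m"
  shows "ws @ [join_letter (Suc n) bs] \<in> sorted_forests r (Suc m) (Suc n) k \<longleftrightarrow>
    (\<forall>i\<in>nonempty_positions bs. 0 < k i) \<and>
    ws @ filter (\<lambda>b. b \<noteq> []) bs \<in>
      sorted_forests r (m + card (nonempty_positions bs)) n (k' bs)"
    (is "?w \<in> _ \<longleftrightarrow> ?pos \<and> ?v \<in> _")
proof -
  have len2: "2 \<le> length bs" using len r by simp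
  have concat_filter: "concat (map stack_sort (filter (\<lambda>b. b \<noteq> []) bs)) = concat (map stack_sort bs)"
    for bs by (induction bs) auto
  have sum_filter: "(\<Sum>b\<leftarrow>filter (\<lambda>b. b \<noteq> []) bs. num_descents i b) = (\<Sum>b\<leftarrow>bs. num_descents i b)"
    for bs i by (induction bs) (auto simp: num_descents_def)
  let ?c = "concat (map stack_sort ws) @ concat (map stack_sort bs)"
  have w: "concat (map stack_sort ?w) = [1..<Suc (Suc n)] \<longleftrightarrow> ?c = [1..<Suc n]"
    by (simp add: stack_sort_join_letter[OF len2 less])
  have v: "concat (map stack_sort ?v) = ?c"
    by (simp add: concat_filter)
  show ?thesis
  \<comment> \<open>If this equation fails, both memberships fail. If it holds, it supplies the
    distinctness on which the lemmas about joined words depend.\<close>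
  proof (cases "?c = [1..<Suc n]")
    case False
    then show ?thesis
      unfolding sorted_forests_def mem_Collect_eq w v by simp
  next
    case True
    then have "distinct ?c" using distinct_upt by metis
    then have dist: "distinct (concat (map stack_sort bs))"
      unfolding distinct_append by blast
    have ne: "join_letter (Suc n) bs \<noteq> []"
      using set_join_letter_eq[OF len2, of "Suc n"] by (metis empty_set insert_not_empty)
    have perm: "(\<forall>w\<in>set ?w. w \<noteq> [] \<and> r_permutation r (set w) w) \<longleftrightarrow>
        (\<forall>w\<in>set ?v. w \<noteq> [] \<and> r_permutation r (set w) w)"
    proof -
      \<comment> \<open>Empty blocks are trivially \<open>r\<close>-permutations of the empty set,
        so filtering them out loses no condition.\<close>
      have "(\<forall>b\<in>set (filter (\<lambda>b. b \<noteq> []) bs). b \<noteq> [] \<and> r_permutation r (set b) b) \<longleftrightarrow>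
          (\<forall>b\<in>set bs. r_permutation r (set b) b)"
        by (auto simp: r_permutation_set_iff nested_def)
      then show ?thesis
        using r_permutation_join_letter[OF len less dist] ne
        by (simp only: set_append ball_Un list.set ball_simps(7)) simp
    qed
    have desc: "(\<Sum>w\<leftarrow>?w. num_descents i w) = k i \<longleftrightarrow>
        (i \<in> nonempty_positions bs \<longrightarrow> 0 < k i) \<and> (\<Sum>w\<leftarrow>?v. num_descents i w) = k' bs i"
      if "i \<le> r" for i
    proof -
      have "i < length bs" using that len by simp
      then show ?thesis
        using num_descents_join_letter[OF len2 less _ dist, of i]
        by (auto simp: sum_filter nonempty_positions_def k'_def)
    qed
    have "nonempty_positions bs \<subseteq> {..r}"
      by (auto simp: nonempty_positions_def len)
    then have "(\<forall>i\<le>r. (\<Sum>w\<leftarrow>?w. num_descents i w) = k i) \<longleftrightarrow>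
        ?pos \<and> (\<forall>i\<le>r. (\<Sum>w\<leftarrow>?v. num_descents i w) = k' bs i)"
      using desc by blast
    moreover have "length ?w = Suc m" "length ?v = m + card (nonempty_positions bs)"
      by (simp_all add: m card_nonempty_positions)
    moreover have "concat (map stack_sort ?w) = [1..<Suc (Suc n)]"
        "concat (map stack_sort ?v) = [1..<Suc n]"
      using True w v by simp_all
    ultimately show ?thesis
      unfolding sorted_forests_def mem_Collect_eq perm by blast
  qed
qed

text \<open>A nonempty sorted word ends in its largest letter, and the concatenation ends in
  \<open>Suc n\<close>. So \<open>Suc n\<close> is the maximum of the last word, occurs there
  \<open>r\<close> times, and cuts it into \<open>r + 1\<close> blocks.\<close>

lemma sorted_forests_Suc_cases:
  assumes "us \<in> sorted_forests r (Suc m) (Suc n) k"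
  obtains ws bs where "us = ws @ [join_letter (Suc n) bs]" "length ws = m" "length bs = Suc r"
    "\<forall>b\<in>set bs. \<forall>x\<in>set b. x < Suc n"
proof -
  obtain ws w where us: "us = ws @ [w]" "length ws = m"
    using assms by (cases us rule: rev_cases) (auto simp: sorted_forests_def)
  have w: "w \<noteq> []" "r_permutation r (set w) w"
      "concat (map stack_sort ws) @ stack_sort w = [1..<Suc (Suc n)]"
    using assms us by (auto simp: sorted_forests_def)
  have "Max (set w) = last (stack_sort w)" using last_stack_sort[OF w(1)] ..
  also have "\<dots> = last (concat (map stack_sort ws) @ stack_sort w)"
    using w(1) by (simp add: last_append)
  also have "\<dots> = Suc n" unfolding w(3) by simp
  finally have max: "Max (set w) = Suc n" .
  let ?bs = "split_letter (Suc n) w"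
  have "Suc n \<in> set w" using max w(1) by (metis Max_in List.finite_set set_empty)
  then have "length ?bs = Suc r"
    using w(2) by (auto simp: length_split_letter r_permutation_def)
  moreover have "x < Suc n" if "b \<in> set ?bs" "x \<in> set b" for b x
  proof -
    have "x \<in> set w - {Suc n}" using that set_split_letter[of "Suc n" w] by blast
    then show ?thesis using max Max_ge[of "set w" x] by force
  qed
  ultimately show thesis
    using us by (intro that[of ws ?bs]) (auto simp: join_letter_split_letter)
qed

lemma sorted_forests_letters:
  "us \<in> sorted_forests r m n k \<Longrightarrow> w \<in> set us \<Longrightarrow> x \<in> set w \<Longrightarrow> x < Suc n"
proof -
  assume us: "us \<in> sorted_forests r m n k" "w \<in> set us" "x \<in> set w"
  then have "x \<in> set (concat (map stack_sort us))" by auto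
  also have "concat (map stack_sort us) = [1..<Suc n]"
    using us(1) unfolding sorted_forests_def by blast
  finally show "x < Suc n" unfolding set_upt by simp
qed

lemma sorted_forests_bij:
  assumes r: "r \<ge> 1"
  shows "\<exists>h. bij_betw h (sorted_forests r (Suc m) (Suc n) k)
    (SIGMA A:{A. A \<subseteq> {..r} \<and> (\<forall>i\<in>A. 0 < k i)}.
      sorted_forests r (m + card A) n (\<lambda>i. k i - (if i \<in> A then 1 else 0)))"
    (is "\<exists>h. bij_betw h ?F ?S")
proof -
  let ?f = "\<lambda>(ws, bs). ws @ [join_letter (Suc n) bs]"
  let ?g = "\<lambda>(ws, bs). (nonempty_positions bs, ws @ filter (\<lambda>b. b \<noteq> []) bs)"
  \<comment> \<open>\<open>T\<close> consists of forests whose last tree is opened into its blocks.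
    Both \<open>?f\<close> (close the tree) and \<open>?g\<close> (delete the root and record the
    support) are bijections from \<open>T\<close>, and the required map is \<open>?g\<close> after
    the inverse of \<open>?f\<close>.\<close>
  define T where "T = {(ws, bs). length ws = m \<and> length bs = Suc r \<and>
    (\<forall>b\<in>set bs. \<forall>x\<in>set b. x < Suc n) \<and> ws @ [join_letter (Suc n) bs] \<in> ?F}"
  have split: "split_letter (Suc n) (join_letter (Suc n) bs) = bs" if "(ws, bs) \<in> T" for ws bs
    using that unfolding T_def by (intro split_letter_join_letter) auto
  have "inj_on ?f T"
    by (rule inj_onI) (use split in \<open>fastforce dest: arg_cong[of _ _ "split_letter (Suc n)"]\<close>)
  moreover have "?f ` T = ?F"
  proof
    show "?f ` T \<subseteq> ?F" by (auto simp: T_def)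
    show "?F \<subseteq> ?f ` T"
    proof
      fix us assume us: "us \<in> ?F"
      then obtain ws bs where ws: "us = ws @ [join_letter (Suc n) bs]" "length ws = m"
          "length bs = Suc r" "\<forall>b\<in>set bs. \<forall>x\<in>set b. x < Suc n"
        by (rule sorted_forests_Suc_cases)
      then have "(ws, bs) \<in> T" using us unfolding T_def by blast
      then show "us \<in> ?f ` T" using ws(1) by force
    qed
  qed
  ultimately have f: "bij_betw ?f T ?F" by (simp add: bij_betw_def)
  have "inj_on ?g T"
  proof (rule inj_onI)
    fix p q assume T: "p \<in> T" "q \<in> T" and eq: "?g p = ?g q"
    obtain ws bs ws' bs' where pq: "p = (ws, bs)" "q = (ws', bs')" by (cases p; cases q)
    have "length ws = length ws'" "length bs = length bs'" using T pq by (auto simp: T_def)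
    then show "p = q" using eq nonempty_positions_inject[of bs bs'] pq by simp
  qed
  moreover have "?g ` T = ?S"
  proof
    show "?g ` T \<subseteq> ?S"
    proof (rule image_subsetI)
      fix p assume "p \<in> T"
      then obtain ws bs where p: "p = (ws, bs)" and T: "length ws = m" "length bs = Suc r"
          "\<forall>b\<in>set bs. \<forall>x\<in>set b. x < Suc n" "ws @ [join_letter (Suc n) bs] \<in> ?F"
        unfolding T_def by blast
      have "nonempty_positions bs \<subseteq> {..r}"
        using T(2) by (auto simp: nonempty_positions_def)
      then show "?g p \<in> ?S"
        using T(4) sorted_forests_join[OF r T(2,3,1), of k] p by simp
    qed
    show "?S \<subseteq> ?g ` T"
    proof (rule subsetI, elim SigmaE)
      fix A us and p
      assume p: "p = (A, us)" and "A \<in> {A. A \<subseteq> {..r} \<and> (\<forall>i\<in>A. 0 < k i)}"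
        and us: "us \<in> sorted_forests r (m + card A) n (\<lambda>i. k i - (if i \<in> A then 1 else 0))"
      then have A: "A \<subseteq> {..r}" "\<forall>i\<in>A. 0 < k i"
        by auto
      \<comment> \<open>The inverse of \<open>?g\<close>: the first \<open>m\<close> words of
        \<open>us\<close> are the untouched trees, and the last \<open>card A\<close> words are the
        nonempty blocks, to be spread over the positions in \<open>A\<close>.\<close>
      have "length us = m + card A" "[] \<notin> set us" using us by (auto simp: sorted_forests_def)
      then have "A \<subseteq> {..<Suc r}" "length (drop m us) = card A" "[] \<notin> set (drop m us)"
        using A(1) in_set_dropD[of "[]" m us] by (auto simp: less_Suc_eq_le)
      then obtain bs where bs: "length bs = Suc r" "nonempty_positions bs = A"
          "filter (\<lambda>b. b \<noteq> []) bs = drop m us"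
        using nonempty_positions_exist by blast
      have len: "length (take m us) = m" using \<open>length us = m + card A\<close> by simp
      have less: "\<forall>b\<in>set bs. \<forall>x\<in>set b. x < Suc n"
      proof (intro ballI)
        fix b x assume "b \<in> set bs" "x \<in> set b"
        then have "b \<in> set (filter (\<lambda>b. b \<noteq> []) bs)" by auto
        then have "b \<in> set us" unfolding bs(3) by (rule in_set_dropD)
        then show "x < Suc n" using sorted_forests_letters[OF us] \<open>x \<in> set b\<close> by blast
      qed
      have "take m us @ [join_letter (Suc n) bs] \<in> ?F"
        using sorted_forests_join[OF r bs(1) less len, of k] A(2) us bs by simp
      then have "(take m us, bs) \<in> T" using bs(1) less len unfolding T_def by blast
      moreover have "p = ?g (take m us, bs)" using p bs by simp
      ultimately show "p \<in> ?g ` T" by (rule rev_image_eqI)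
    qed
  qed
  ultimately have "bij_betw ?g T ?S" by (simp add: bij_betw_def)
  with bij_betw_inv_into[OF f] show ?thesis
    by (blast intro: bij_betw_trans)
qed

subsection \<open>The closed formula\<close>

text \<open>Replacing \<open>g i\<close> by 0 kills exactly the terms whose subset misses
  \<open>i\<close>. The restricted sum is then the ordinary expansion of a product of sums.\<close>

lemma sum_Pow_prod_mem:
  fixes f g :: "'a \<Rightarrow> 'b::comm_ring_1"
  assumes "finite S" "i \<in> S"
  shows "(\<Sum>A\<in>Pow S. (if i \<in> A then (\<Prod>j\<in>A. f j) * (\<Prod>j\<in>S - A. g j) else 0)) =
    f i * (\<Prod>j\<in>S - {i}. f j + g j)"
proof -
  let ?h = "g(i := 0)"
  have "(\<Prod>j\<in>A. f j) * (\<Prod>j\<in>S - A. ?h j) =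
      (if i \<in> A then (\<Prod>j\<in>A. f j) * (\<Prod>j\<in>S - A. g j) else 0)" for A
  proof (cases "i \<in> A")
    case True
    then have "(\<Prod>j\<in>S - A. ?h j) = (\<Prod>j\<in>S - A. g j)" by (intro prod.cong) auto
    then show ?thesis using True by simp
  next
    case False
    then have "(\<Prod>j\<in>S - A. ?h j) = 0" using assms by (intro prod_zero) auto
    then show ?thesis using False by simp
  qed
  then have "(\<Sum>A\<in>Pow S. (if i \<in> A then (\<Prod>j\<in>A. f j) * (\<Prod>j\<in>S - A. g j) else 0)) =
      (\<Prod>j\<in>S. f j + ?h j)"
    by (simp add: prod_add[OF assms(1)])
  also have "\<dots> = (f i + ?h i) * (\<Prod>j\<in>S - {i}. f j + ?h j)"
    using assms by (rule prod.remove)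
  also have "(\<Prod>j\<in>S - {i}. f j + ?h j) = (\<Prod>j\<in>S - {i}. f j + g j)"
    by (intro prod.cong) auto
  finally show ?thesis by simp
qed

text \<open>Write \<open>card A\<close> as a sum of indicators over \<open>i\<close> and exchange
  the two sums.\<close>

lemma sum_Pow_card_prod:
  fixes f g :: "'a \<Rightarrow> 'b::comm_ring_1"
  assumes "finite S"
  shows "(\<Sum>A\<in>Pow S. of_nat (card A) * ((\<Prod>j\<in>A. f j) * (\<Prod>j\<in>S - A. g j))) =
    (\<Sum>i\<in>S. f i * (\<Prod>j\<in>S - {i}. f j + g j))"
proof -
  have "of_nat (card A) * c = (\<Sum>i\<in>S. if i \<in> A then c else 0)" if "A \<in> Pow S" for A and c :: 'b
    using that assms by (simp add: sum.inter_restrict[symmetric] Int_absorb1)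
  then have "(\<Sum>A\<in>Pow S. of_nat (card A) * ((\<Prod>j\<in>A. f j) * (\<Prod>j\<in>S - A. g j))) =
      (\<Sum>A\<in>Pow S. \<Sum>i\<in>S. if i \<in> A then (\<Prod>j\<in>A. f j) * (\<Prod>j\<in>S - A. g j) else 0)"
    by (intro sum.cong) auto
  also have "\<dots> = (\<Sum>i\<in>S. f i * (\<Prod>j\<in>S - {i}. f j + g j))"
    by (subst sum.swap) (simp add: sum_Pow_prod_mem[OF assms] cong: sum.cong)
  finally show ?thesis .
qed

text \<open>The sum arising in the recurrence for forests. The part with factor \<open>c\<close> is
  a plain product expansion by Pascal's rule (\<open>fg\<close>). The part with
  \<open>card A\<close> is evaluated by the previous lemma and the absorption identity for binomials
  (\<open>f\<close>).\<close>

lemma sum_supports_binomial: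
  fixes k :: "nat \<Rightarrow> nat" and c :: real
  assumes "finite S"
  shows "(\<Sum>A | A \<subseteq> S \<and> (\<forall>i\<in>A. 0 < k i).
      (c + real (card A)) * (\<Prod>i\<in>S. real (n choose (k i - (if i \<in> A then 1 else 0))))) =
    (c + real (\<Sum>i\<in>S. k i) / real (Suc n)) * (\<Prod>i\<in>S. real (Suc n choose k i))"
proof -
  \<comment> \<open>The value 0 at \<open>k i = 0\<close> is essential: truncated subtraction would
    give \<open>n choose 0 = 1\<close> there. With 0, every set \<open>A\<close> containing such an
    \<open>i\<close> contributes nothing, so the sum may run over all of
    \<open>Pow S\<close>.\<close>
  define f where "f i = (if k i = 0 then 0 else real (n choose (k i - 1)))" for i
  define g where "g i = real (n choose k i)" for i
  define P where "P = (\<Prod>i\<in>S. real (Suc n choose k i))"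
  have fg: "f i + g i = real (Suc n choose k i)" for i
    by (cases "k i") (auto simp: f_def g_def)
  have f: "f i = real (k i) / real (Suc n) * real (Suc n choose k i)" for i
  proof (cases "k i")
    case (Suc j)
    have "real (Suc j) * real (Suc n choose Suc j) = real (Suc n) * real (n choose j)"
      using Suc_times_binomial_eq[of n j] by (metis mult.commute of_nat_mult)
    then show ?thesis by (simp add: f_def Suc field_simps del: binomial_Suc_Suc)
  qed (simp add: f_def)
  have "(\<Sum>A | A \<subseteq> S \<and> (\<forall>i\<in>A. 0 < k i).
      (c + real (card A)) * (\<Prod>i\<in>S. real (n choose (k i - (if i \<in> A then 1 else 0))))) =
    (\<Sum>A | A \<subseteq> S \<and> (\<forall>i\<in>A. 0 < k i).
      (c + real (card A)) * ((\<Prod>i\<in>A. f i) * (\<Prod>i\<in>S - A. g i)))"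
  proof (intro sum.cong refl arg_cong2[where f = "(*)"])
    fix A assume A: "A \<in> {A. A \<subseteq> S \<and> (\<forall>i\<in>A. 0 < k i)}"
    have "(\<Prod>i\<in>S. real (n choose (k i - (if i \<in> A then 1 else 0)))) =
        (\<Prod>i\<in>S - A. real (n choose (k i - (if i \<in> A then 1 else 0)))) *
        (\<Prod>i\<in>A. real (n choose (k i - (if i \<in> A then 1 else 0))))"
      using A assms by (intro prod.subset_diff) auto
    moreover have "(\<Prod>i\<in>S - A. real (n choose (k i - (if i \<in> A then 1 else 0)))) = (\<Prod>i\<in>S - A. g i)"
      by (intro prod.cong) (auto simp: g_def)
    moreover have "(\<Prod>i\<in>A. real (n choose (k i - (if i \<in> A then 1 else 0)))) = (\<Prod>i\<in>A. f i)"
      using A by (intro prod.cong) (auto simp: f_def)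
    ultimately show "(\<Prod>i\<in>S. real (n choose (k i - (if i \<in> A then 1 else 0)))) =
        (\<Prod>i\<in>A. f i) * (\<Prod>i\<in>S - A. g i)"
      by simp
  qed
  also have "\<dots> = (\<Sum>A\<in>Pow S. (c + real (card A)) * ((\<Prod>i\<in>A. f i) * (\<Prod>i\<in>S - A. g i)))"
  proof (intro sum.mono_neutral_left ballI)
    fix A assume "A \<in> Pow S - {A. A \<subseteq> S \<and> (\<forall>i\<in>A. 0 < k i)}"
    then obtain i where "i \<in> A" "f i = 0" "finite A"
      using finite_subset[OF _ assms] by (auto simp: f_def)
    then have "(\<Prod>i\<in>A. f i) = 0" by (intro prod_zero) auto
    then show "(c + real (card A)) * ((\<Prod>i\<in>A. f i) * (\<Prod>i\<in>S - A. g i)) = 0" by simp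
  qed (use assms in auto)
  also have "\<dots> = c * (\<Sum>A\<in>Pow S. (\<Prod>i\<in>A. f i) * (\<Prod>i\<in>S - A. g i)) +
      (\<Sum>A\<in>Pow S. real (card A) * ((\<Prod>i\<in>A. f i) * (\<Prod>i\<in>S - A. g i)))"
    by (simp add: distrib_right sum.distrib sum_distrib_left)
  also have "\<dots> = c * (\<Prod>i\<in>S. f i + g i) + (\<Sum>i\<in>S. f i * (\<Prod>j\<in>S - {i}. f j + g j))"
    by (simp only: prod_add[OF assms] sum_Pow_card_prod[OF assms])
  also have "(\<Sum>i\<in>S. f i * (\<Prod>j\<in>S - {i}. f j + g j)) =
      (\<Sum>i\<in>S. real (k i) / real (Suc n) * P)"
  proof (intro sum.cong refl)
    fix i assume "i \<in> S"
    then have "P = real (Suc n choose k i) * (\<Prod>j\<in>S - {i}. real (Suc n choose k j))"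
      unfolding P_def by (rule prod.remove[OF assms])
    then show "f i * (\<Prod>j\<in>S - {i}. f j + g j) = real (k i) / real (Suc n) * P"
      unfolding fg by (simp add: f del: binomial_Suc_Suc)
  qed
  also have "\<dots> = real (\<Sum>i\<in>S. k i) / real (Suc n) * P"
    by (simp only: sum_distrib_right[symmetric] sum_divide_distrib[symmetric] of_nat_sum)
  also have "(\<Prod>i\<in>S. f i + g i) = P" unfolding fg P_def ..
  finally show ?thesis unfolding P_def by (simp only: distrib_right)
qed

section \<open>Solving the recurrence\<close>

lemma sorted_forests_0: "sorted_forests r m 0 k \<subseteq> {[]}"
proof
  fix ws assume ws: "ws \<in> sorted_forests r m 0 k"
  then have "\<forall>w\<in>set ws. w = []" "\<forall>w\<in>set ws. w \<noteq> []"
    unfolding sorted_forests_def by auto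
  then show "ws \<in> {[]}" by (cases ws) auto
qed

lemma sorted_forests_0_Suc: "sorted_forests r 0 (Suc n) k = {}"
  by (auto simp: sorted_forests_def)

text \<open>Needed to count the disjoint union in the recurrence by summing over its fibres. The
  recurrence itself yields finiteness by induction.\<close>

lemma finite_sorted_forests: "r \<ge> 1 \<Longrightarrow> finite (sorted_forests r m n k)"
proof (induction n arbitrary: m k)
  case 0
  then show ?case using finite_subset[OF sorted_forests_0] by simp
next
  case (Suc n)
  show ?case
  proof (cases m)
    case 0
    then show ?thesis by (simp add: sorted_forests_0_Suc)
  next
    case m: (Suc m')
    obtain h where "bij_betw h (sorted_forests r (Suc m') (Suc n) k)
      (SIGMA A:{A. A \<subseteq> {..r} \<and> (\<forall>i\<in>A. 0 < k i)}.
        sorted_forests r (m' + card A) n (\<lambda>i. k i - (if i \<in> A then 1 else 0)))"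
      using sorted_forests_bij[OF Suc.prems] by blast
    moreover have "finite (SIGMA A:{A. A \<subseteq> {..r} \<and> (\<forall>i\<in>A. 0 < k i)}.
        sorted_forests r (m' + card A) n (\<lambda>i. k i - (if i \<in> A then 1 else 0)))"
      using Suc.IH[OF Suc.prems] by (intro finite_SigmaI) auto
    ultimately show ?thesis unfolding m by (simp add: bij_betw_finite)
  qed
qed

text \<open>The case \<open>n = 0\<close> is separate because the single empty forest counts 1,
  whereas the quotient \<open>m / n\<close> would be 0 by the convention for division by
  zero.\<close>

lemma card_sorted_forests:
  assumes "r \<ge> 1" "m + (\<Sum>i\<le>r. k i) = n"
  shows "real (card (sorted_forests r m n k)) =
    (if n = 0 then 1 else real m / real n * (\<Prod>i\<le>r. real (n choose k i)))"
  using assms(2)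
proof (induction n arbitrary: m k)
  case 0
  then have "[] \<in> sorted_forests r m 0 k"
    by (simp add: sorted_forests_def)
  then have "sorted_forests r m 0 k = {[]}" using sorted_forests_0 by blast
  then show ?case by simp
next
  case (Suc n)
  show ?case
  proof (cases m)
    case 0
    then show ?thesis by (simp add: sorted_forests_0_Suc)
  next
    case m: (Suc m')
    let ?I = "{A. A \<subseteq> {..r} \<and> (\<forall>i\<in>A. 0 < k i)}"
    let ?k = "\<lambda>A i. k i - (if i \<in> A then 1 else 0)"
    have sum_k: "m' + (\<Sum>i\<le>r. k i) = n" using Suc.prems m by simp
    \<comment> \<open>The hypothesis survives the recurrence: \<open>card A\<close> moves from the
      sum of the \<open>k i\<close> to the number of trees, and the deleted vertex accounts for the
      drop from \<open>Suc n\<close> to \<open>n\<close>.\<close>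
    have total: "m' + card A + (\<Sum>i\<le>r. ?k A i) = n" if "A \<in> ?I" for A
    proof -
      have "(\<Sum>i\<le>r. k i) = (\<Sum>i\<le>r. ?k A i + (if i \<in> A then 1 else 0))"
        using that by (intro sum.cong) auto
      also have "\<dots> = (\<Sum>i\<le>r. ?k A i) + card A"
        using that by (simp add: sum.distrib sum.inter_restrict[symmetric] Int_absorb1)
      finally show ?thesis using sum_k by simp
    qed
    obtain h where "bij_betw h (sorted_forests r (Suc m') (Suc n) k)
        (SIGMA A:?I. sorted_forests r (m' + card A) n (?k A))"
      using sorted_forests_bij[OF assms(1)] by blast
    then have "card (sorted_forests r m (Suc n) k) =
        card (SIGMA A:?I. sorted_forests r (m' + card A) n (?k A))"
      unfolding m by (rule bij_betw_same_card)
    also have "\<dots> = (\<Sum>A\<in>?I. card (sorted_forests r (m' + card A) n (?k A)))"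
      using finite_sorted_forests[OF assms(1)] by (intro card_SigmaI) auto
    finally have card: "real (card (sorted_forests r m (Suc n) k)) =
        (\<Sum>A\<in>?I. real (card (sorted_forests r (m' + card A) n (?k A))))"
      by simp
    show ?thesis
    \<comment> \<open>A forest with one vertex: the induction hypothesis returns its exceptional
      value 1 instead of the quotient formula.\<close>
    proof (cases "n = 0")
      case True
      then have k: "k i = 0" if "i \<le> r" for i using sum_k that by simp
      then have "?I = {{}}" by fastforce
      moreover have "real (card (sorted_forests r m' n k)) = 1"
        using Suc.IH[of m' k] sum_k True by simp
      ultimately show ?thesis
        unfolding card using True k m sum_k by simp
    next
      case False
      let ?P = "\<Prod>i\<le>r. real (Suc n choose k i)"
      have "real (card (sorted_forests r (m' + card A) n (?k A))) =
          1 / real n * ((real m' + real (card A)) * (\<Prod>i\<le>r. real (n choose ?k A i)))"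
        if "A \<in> ?I" for A
        using Suc.IH[OF total[OF that]] False by simp
      then have "real (card (sorted_forests r m (Suc n) k)) =
          1 / real n * (\<Sum>A\<in>?I. (real m' + real (card A)) * (\<Prod>i\<le>r. real (n choose ?k A i)))"
        unfolding card sum_distrib_left by (intro sum.cong) auto
      also have "\<dots> = 1 / real n * ((real m' + real (\<Sum>i\<le>r. k i) / real (Suc n)) * ?P)"
        by (subst sum_supports_binomial) auto
      also have "real (\<Sum>i\<le>r. k i) = real n - real m'"
        using sum_k by linarith
      also have "1 / real n * ((real m' + (real n - real m') / real (Suc n)) * ?P) =
          real m / real (Suc n) * ?P"
      proof -
        \<comment> \<open>Over the denominator \<open>n + 1\<close> the numerator is
          \<open>m' * (n + 1) + n - m' = n * (m' + 1)\<close>, so the factor \<open>n\<close>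
          cancels against \<open>1 / n\<close>.\<close>
        have "real m' + (real n - real m') / real (Suc n) = real n * (real m / real (Suc n))"
          by (simp add: m field_simps)
        then show ?thesis using False by simp
      qed
      finally show ?thesis by simp
    qed
  qed
qed

theorem theorem1:
  fixes r n :: nat and k :: "nat \<Rightarrow> nat"
  assumes "r \<ge> 1"
    and "n = 1 + (\<Sum>i\<le>r. k i)"
  shows "real (card {w. r_permutation r {1..n} w \<and> stack_sort w = [1..<Suc n] \<and>
                        (\<forall>i\<le>r. num_descents i w = k i)})
         = 1 / real n * (\<Prod>i\<le>r. real (n choose k i))"
proof -
  let ?W = "{w. r_permutation r {1..n} w \<and> stack_sort w = [1..<Suc n] \<and>
    (\<forall>i\<le>r. num_descents i w = k i)}"
  have set: "set w = {1..n} \<and> w \<noteq> []" if "stack_sort w = [1..<Suc n]" for w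
  proof -
    have "set w = set [1..<Suc n]" using set_stack_sort[of w] that by simp
    then have "set w = {1..n}" by auto
    moreover have "1 \<in> {1..n}" using assms(2) by simp
    ultimately show ?thesis by auto
  qed
  \<comment> \<open>The words to be counted are the forests with one tree. Sorting to the identity
    already forces the letter set \<open>{1..n}\<close>, and \<open>n >= 1\<close> excludes the
    empty word. The factor \<open>m / n\<close> then becomes \<open>1 / n\<close>.\<close>
  have "sorted_forests r 1 n k = (\<lambda>w. [w]) ` ?W"
    using set by (fastforce simp: sorted_forests_def length_Suc_conv image_iff)
  moreover have "inj_on (\<lambda>w. [w]) ?W" by (simp add: inj_on_def)
  ultimately have "card ?W = card (sorted_forests r 1 n k)"
    by (simp add: card_image)
  then show ?thesis
    using card_sorted_forests[OF assms(1), of 1 k n] assms(2) by simp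
qed

end
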